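(* Let $N\ge1$, let $\mathcal{G}\subseteq U(N)$ be a compact group of unitary matrices, and let $\mathcal{M}_1,\mathcal{M}_2$ be laws of random $N\times N$ Hermitian matrices. Suppose that $\mathcal{M}_1$ is $\mathcal{G}$-invariant and that, for $M_1\sim\mathcal{M}_1$, $\mathcal{G}$ is almost surely $e^{M_1}$-symmetrizing. Then $$F(\mathcal{M}_1+\mathcal{M}_2)\le F(\mathcal{M}_1)+F(\mathcal{M}_2).$$
   Context: For a Hermitian $N\times N$ matrix $M$, set $Z(M)=\mathrm{Tr}(e^M)/N$. For a law $\mathcal{M}$ of a random $N\times N$ Hermitian matrix, the average free energy is $F(\mathcal{M})=\mathbb{E}^{M\sim\mathcal{M}}[\log Z(M)]$. The free energies $F(\mathcal{M}_1)$, $F(\mathcal{M}_2)$, $F(\mathcal{M}_1+\mathcal{M}_2)$ are assumed to be finite. $\mathcal{M}_1+\mathcal{M}_2$ denotes the law of $M_1+M_2$ where $(M_1,M_2)\sim\mathcal{M}_1\times\mathcal{M}_2$ are independent. $\mathcal{M}$ is $\mathcal{G}$-invariant if for $M\sim\mathcal{M}$ and every fixed $g\in\mathcal{G}$, $gMg^{-1}\sim\mathcal{M}$. $\mathcal{G}$ is $M$-symmetrizing, for an $N\times N$ matrix $M$, if $$\mathbb{E}^{g\in\mathcal{G}}[gMg^{-1}]=\frac{\mathrm{Tr}(M)}{N}\,I_N,$$ where $\mathbb{E}^{g\in\mathcal{G}}$ denotes expectation with respect to the Haar probability measure on $\mathcal{G}$ and $I_N$ is the identity matrix. *)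

theory Defs
  imports "HOL-Probability.Probability"
begin

text \<open>Complex \<open>N \<times> N\<close> matrices have type \<^typ>\<open>complex^'n^'n\<close> with \<open>N = CARD('n)\<close>, so
  \<open>N \<ge> 1\<close> holds automatically.\<close>

definition conj_transpose :: "complex^'n^'m \<Rightarrow> complex^'m^'n" where
  "conj_transpose A = (\<chi> i j. cnj (A $ j $ i))"

definition hermitian_matrix :: "complex^'n^'n \<Rightarrow> bool" where
  "hermitian_matrix A \<longleftrightarrow> conj_transpose A = A"

definition unitary_matrix :: "complex^'n^'n \<Rightarrow> bool" where
  "unitary_matrix U \<longleftrightarrow> conj_transpose U ** U = mat 1 \<and> U ** conj_transpose U = mat 1"

text \<open>The product of the type class \<open>times\<close> on vectors is componentwise, so neither
  \<open>A ^ k\<close> nor the library's \<open>exp\<close> can be used; the power series is written with \<open>**\<close>.\<close>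

definition matrix_power :: "complex^'n^'n \<Rightarrow> nat \<Rightarrow> complex^'n^'n" where
  "matrix_power A k = (((**) A) ^^ k) (mat 1)"

definition matrix_exp :: "complex^'n^'n \<Rightarrow> complex^'n^'n" where
  "matrix_exp A = (\<Sum>k. matrix_power A k /\<^sub>R fact k)"

text \<open>\<open>Tr (e\<^sup>M)\<close> is real for Hermitian \<open>M\<close>; \<open>Re\<close> only changes the type.\<close>

definition partition_fn :: "complex^'n^'n \<Rightarrow> real" where
  "partition_fn M = Re (trace (matrix_exp M)) / real CARD('n)"

definition hermitian_law :: "(complex^'n^'n) measure \<Rightarrow> bool" where
  "hermitian_law P \<longleftrightarrow>
     prob_space P \<and> sets P = sets borel \<and> (AE M in P. hermitian_matrix M)"

definition free_energy :: "(complex^'n^'n) measure \<Rightarrow> real" where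
  "free_energy P = (LINT M|P. ln (partition_fn M))"

text \<open>The Bochner integral of a non-integrable function is \<open>0\<close>, so finiteness of the free energy
  has to be a separate condition.\<close>

definition finite_free_energy :: "(complex^'n^'n) measure \<Rightarrow> bool" where
  "finite_free_energy P \<longleftrightarrow> integrable P (\<lambda>M. ln (partition_fn M))"

text \<open>The library's \<open>convolution\<close> requires an ordered Euclidean space, which complex matrices
  are not.\<close>

definition sum_law ::
    "(complex^'n^'n) measure \<Rightarrow> (complex^'n^'n) measure \<Rightarrow> (complex^'n^'n) measure" where
  "sum_law P Q = distr (P \<Otimes>\<^sub>M Q) borel (\<lambda>(M\<^sub>1, M\<^sub>2). M\<^sub>1 + M\<^sub>2)"

definition compact_unitary_group :: "(complex^'n^'n) set \<Rightarrow> bool" where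
  "compact_unitary_group G \<longleftrightarrow>
     compact G \<and> (\<forall>g\<in>G. unitary_matrix g) \<and> mat 1 \<in> G \<and>
     (\<forall>g\<in>G. \<forall>h\<in>G. g ** h \<in> G) \<and> (\<forall>g\<in>G. matrix_inv g \<in> G)"

text \<open>A compact group has exactly one Borel probability measure invariant under left
  translations.\<close>

definition haar_prob_measure :: "(complex^'n^'n) set \<Rightarrow> (complex^'n^'n) measure \<Rightarrow> bool" where
  "haar_prob_measure G \<mu> \<longleftrightarrow>
     prob_space \<mu> \<and> sets \<mu> = sets (restrict_space borel G) \<and>
     (\<forall>g\<in>G. distr \<mu> \<mu> (\<lambda>h. g ** h) = \<mu>)"

definition invariant_law :: "(complex^'n^'n) set \<Rightarrow> (complex^'n^'n) measure \<Rightarrow> bool" where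
  "invariant_law G P \<longleftrightarrow> (\<forall>g\<in>G. distr P borel (\<lambda>M. g ** M ** matrix_inv g) = P)"

text \<open>Here \<open>\<mu>\<close> is the Haar probability measure of the group; \<open>mat c\<close> is \<open>c\<close> times the
  identity matrix.\<close>

definition symmetrizing :: "(complex^'n^'n) measure \<Rightarrow> complex^'n^'n \<Rightarrow> bool" where
  "symmetrizing \<mu> A \<longleftrightarrow>
     (LINT g|\<mu>. g ** A ** matrix_inv g) = mat (trace A / of_nat CARD('n))"

end

theory Submission
  imports Defs
begin

text \<open>
  The analytic core is the Golden-Thompson inequality: the trace of \<open>e\<^sup>A\<^sup>+\<^sup>B\<close> is at most that of
  \<open>e\<^sup>A e\<^sup>B\<close> for Hermitian \<open>A\<close> and \<open>B\<close> (\<open>golden_thompson\<close>). Let \<open>M\<^sub>1\<close>, \<open>M\<^sub>2\<close> be independent samples and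
  \<open>g\<close> a group element. By invariance \<open>g M\<^sub>1 g\<^sup>-\<^sup>1 + M\<^sub>2\<close> has the same law as \<open>M\<^sub>1 + M\<^sub>2\<close>, so the free energy
  of the sum is also the mean of \<open>log Z(g M\<^sub>1 g\<^sup>-\<^sup>1 + M\<^sub>2)\<close> over all of \<open>g\<close>, \<open>M\<^sub>1\<close>, \<open>M\<^sub>2\<close>. Hold the matrices
  fixed and average over \<open>g\<close> first. Golden-Thompson bounds the partition function by the normalized
  trace of \<open>g e\<^sup>M g\<^sup>-\<^sup>1 e\<^sup>M\<^sup>'\<close> with \<open>M = M\<^sub>1\<close> and \<open>M' = M\<^sub>2\<close>. This is linear in \<open>g e\<^sup>M g\<^sup>-\<^sup>1\<close>, whose
  average is \<open>Z(M\<^sub>1)\<close> times the identity because the group is symmetrizing, so the bound averages to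
  \<open>Z(M\<^sub>1) Z(M\<^sub>2)\<close> (\<open>trace_symmetrized\<close>). Jensen's inequality for the logarithm
  (\<open>integral_ln_le_ln_bound\<close>) bounds the average of \<open>log Z\<close> by \<open>log Z(M\<^sub>1) + log Z(M\<^sub>2)\<close>.

  Golden-Thompson is proved by approximation. Repeated Cauchy-Schwarz gives a Hoelder inequality
  for products of \<open>2\<^sup>k\<close> matrices, from which the trace of \<open>(AB)\<^sup>n\<close> is at most that of \<open>A\<^sup>n B\<^sup>n\<close> when
  \<open>n\<close> is a power of two (\<open>trace_power_mult_le\<close>). This is applied to \<open>I + A/n\<close> and \<open>I + B/n\<close>,
  and \<open>n\<close> tends to infinity along the powers of two. Both sides converge to traces of exponentials
  because \<open>(I + D\<^sub>n/n)\<^sup>n\<close> tends to \<open>e\<^sup>C\<close> whenever \<open>D\<^sub>n\<close> tends to \<open>C\<close> (\<open>matrix_power_tendsto_exp\<close>).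
\<close>

section \<open>Matrix algebra\<close>

lemma matrix_eqI: "(\<And>i j. A $ i $ j = B $ i $ j) \<Longrightarrow> A = B"
  by (simp add: vec_eq_iff)

lemma bounded_bilinear_matrix_mult:
  "bounded_bilinear ((**) :: complex^'n^'m \<Rightarrow> complex^'p^'n \<Rightarrow> complex^'p^'m)"
proof -
  have "bilinear ((**) :: complex^'n^'m \<Rightarrow> complex^'p^'n \<Rightarrow> complex^'p^'m)"
    unfolding bilinear_def
    by (auto intro!: linearI matrix_eqI simp: matrix_matrix_mult_def algebra_simps sum.distrib scaleR_sum_right)
  thus ?thesis
    by (simp add: bilinear_conv_bounded_bilinear)
qed

interpretation matrix_mult: bounded_bilinear "(**) :: complex^'n^'m \<Rightarrow> complex^'p^'n \<Rightarrow> complex^'p^'m"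
  by (rule bounded_bilinear_matrix_mult)

lemma bounded_linear_trace: "bounded_linear (trace :: complex^'n^'n \<Rightarrow> complex)"
  by (rule linear_conv_bounded_linear[THEN iffD1])
     (auto intro!: linearI simp: trace_def sum.distrib scaleR_sum_right)

lemmas trace_scaleR = linear_scale[OF bounded_linear.linear[OF bounded_linear_trace]]

lemma bounded_linear_conj_transpose:
  "bounded_linear (conj_transpose :: complex^'n^'m \<Rightarrow> complex^'m^'n)"
  by (rule linear_conv_bounded_linear[THEN iffD1])
     (auto intro!: linearI matrix_eqI simp: conj_transpose_def)

lemmas conj_transpose_scaleR = linear_scale[OF bounded_linear.linear[OF bounded_linear_conj_transpose]]

lemma conj_transpose_mult: "conj_transpose (A ** B) = conj_transpose B ** conj_transpose A"
  by (auto intro!: matrix_eqI simp: conj_transpose_def matrix_matrix_mult_def mult.commute)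

lemma conj_transpose_conj_transpose [simp]: "conj_transpose (conj_transpose A) = A"
  by (auto intro!: matrix_eqI simp: conj_transpose_def)

lemma conj_transpose_mat_1 [simp]: "conj_transpose (mat 1) = mat 1"
  by (simp add: conj_transpose_def mat_def vec_eq_iff)

lemma trace_conj_transpose: "trace (conj_transpose A) = cnj (trace A)"
  by (simp add: trace_def conj_transpose_def)

lemma matrix_power_0 [simp]: "matrix_power A 0 = mat 1"
  and matrix_power_Suc [simp]: "matrix_power A (Suc k) = A ** matrix_power A k"
  by (simp_all add: matrix_power_def)

lemma matrix_power_add: "matrix_power A (m + n) = matrix_power A m ** matrix_power A n"
  by (induction m) (simp_all add: matrix_mul_assoc)

lemma matrix_power_mult: "matrix_power A (m * n) = matrix_power (matrix_power A m) n"
  by (induction n) (simp_all add: matrix_power_add)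

lemma matrix_power_double: "matrix_power A (2 * n) = matrix_power (A ** A) n"
  unfolding matrix_power_mult by (simp add: numeral_2_eq_2)

lemma matrix_power_scaleR: "matrix_power (c *\<^sub>R A) n = c ^ n *\<^sub>R matrix_power A n"
  by (induction n) (simp_all add: matrix_mult.scaleR_left matrix_mult.scaleR_right)

lemma matrix_power_mat_1 [simp]: "matrix_power (mat 1) n = mat 1"
  by (induction n) simp_all

lemma conj_transpose_matrix_power:
  "conj_transpose (matrix_power A n) = matrix_power (conj_transpose A) n"
proof (induction n)
  case (Suc n)
  have "matrix_power (conj_transpose A) (Suc n) = matrix_power (conj_transpose A) (n + 1)"
    by simp
  also have "\<dots> = conj_transpose (matrix_power A (Suc n))"
    unfolding matrix_power_add using Suc by (simp add: conj_transpose_mult)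
  finally show ?case ..
qed simp

lemma matrix_power_mult_shift:
  "matrix_power (A ** B) n ** A = A ** matrix_power (B ** A) n"
  by (induction n) (simp_all add: matrix_mul_assoc[symmetric])

lemma trace_matrix_power_mult_commute:
  fixes A B :: "complex^'n^'n"
  shows "trace (matrix_power (A ** B) n) = trace (matrix_power (B ** A) n)"
proof (cases n)
  case (Suc m)
  have "trace (matrix_power (A ** B) n) = trace ((A ** matrix_power (B ** A) m) ** B)"
    using matrix_power_add[of "A ** B" m 1]
    by (simp add: Suc matrix_mul_assoc matrix_power_mult_shift)
  also have "\<dots> = trace (B ** (A ** matrix_power (B ** A) m))"
    by (rule trace_mul_sym)
  also have "\<dots> = trace (matrix_power (B ** A) n)"
    by (simp add: Suc matrix_mul_assoc)
  finally show ?thesis .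
qed simp

text \<open>Through this identity Cauchy-Schwarz for the real inner product, with the Frobenius norm,
  becomes an inequality for traces.\<close>

lemma trace_mult_conj_transpose: "Re (trace (A ** conj_transpose B)) = inner A B"
  by (simp add: trace_def matrix_matrix_mult_def conj_transpose_def inner_vec_def inner_complex_def)

lemma norm_conj_transpose [simp]: "norm (conj_transpose A) = norm A"
proof -
  have "inner (conj_transpose A) (conj_transpose A) = Re (trace (conj_transpose A ** A))"
    using trace_mult_conj_transpose[of "conj_transpose A" "conj_transpose A"] by simp
  also have "\<dots> = inner A A"
    using trace_mul_sym[of "conj_transpose A" A] trace_mult_conj_transpose[of A A] by simp
  finally show ?thesis by (simp add: norm_eq)
qed

lemma trace_gram: "Re (trace (A ** conj_transpose A)) = norm A ^ 2"
  by (simp add: trace_mult_conj_transpose power2_norm_eq_inner)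

lemma abs_trace_mult_le: "\<bar>Re (trace (A ** B))\<bar> \<le> norm A * norm B"
  using Cauchy_Schwarz_ineq2[of A "conj_transpose B"]
  by (simp flip: trace_mult_conj_transpose)

section \<open>A Hoelder inequality for traces\<close>

text \<open>The product of \<open>f 0, \<dots>, f (2\<^sup>k - 1)\<close> in this order, multiplying neighbours first, as the
  induction below groups the factors in pairs.\<close>

fun dyadic_prod :: "nat \<Rightarrow> (nat \<Rightarrow> complex^'n^'n) \<Rightarrow> complex^'n^'n" where
  "dyadic_prod 0 f = f 0"
| "dyadic_prod (Suc k) f = dyadic_prod k (\<lambda>i. f (2 * i) ** f (2 * i + 1))"

lemma dyadic_prod_const: "dyadic_prod k (\<lambda>_. A) = matrix_power A (2 ^ k)"
  by (induction k arbitrary: A) (simp_all add: matrix_power_double)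

text \<open>
  The hypothesis says that every factor has Schatten norm at most one for the exponent \<open>2\<^sup>k\<^sup>+\<^sup>1\<close>, so
  this is the normalized Hoelder inequality for \<open>2\<^sup>k\<^sup>+\<^sup>1\<close> factors. For two factors it is
  Cauchy-Schwarz. With more factors, neighbours are paired, and it has to be seen that a pair \<open>AB\<close>
  has norm at most one for the halved exponent. By cyclicity a power of that norm is the trace of an
  alternating product of \<open>A\<^sup>*A\<close> and \<open>BB\<^sup>*\<close>, to which the induction hypothesis applies once more.
\<close>

lemma trace_dyadic_prod_le_1:
  assumes "\<And>i. Re (trace (matrix_power (f i ** conj_transpose (f i)) (2 ^ k))) \<le> 1"
  shows "\<bar>Re (trace (dyadic_prod (Suc k) f))\<bar> \<le> 1"
  using assms
proof (induction k arbitrary: f)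
  case 0
  hence "norm (f i) \<le> 1" for i
    by (simp add: trace_gram power_le_one_iff)
  hence "norm (f 0) * norm (f 1) \<le> 1"
    by (meson mult_le_one norm_ge_zero)
  thus ?case
    using abs_trace_mult_le[of "f 0" "f 1"] by simp
next
  case (Suc k)
  have "Re (trace (matrix_power (A ** B ** conj_transpose (A ** B)) (2 ^ k))) \<le> 1"
    if A: "A = f i" and B: "B = f j" for A B i j
  proof -
    let ?C = "conj_transpose A ** A" and ?D = "B ** conj_transpose B"
    let ?g = "\<lambda>m::nat. if even m then ?C else ?D"
    have C: "Re (trace (matrix_power (?C ** conj_transpose ?C) (2 ^ k))) \<le> 1"
    proof -
      have "trace (matrix_power (?C ** conj_transpose ?C) (2 ^ k)) = trace (matrix_power ?C (2 ^ Suc k))"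
        by (simp add: conj_transpose_mult matrix_power_double)
      also have "\<dots> = trace (matrix_power (A ** conj_transpose A) (2 ^ Suc k))"
        by (rule trace_matrix_power_mult_commute)
      finally show ?thesis using Suc.prems[of i] A by simp
    qed
    have D: "Re (trace (matrix_power (?D ** conj_transpose ?D) (2 ^ k))) \<le> 1"
      using Suc.prems[of j] B by (simp add: conj_transpose_mult matrix_power_double)
    have "\<bar>Re (trace (dyadic_prod (Suc k) ?g))\<bar> \<le> 1"
      by (rule Suc.IH) (use C D in auto)
    hence "Re (trace (matrix_power (?C ** ?D) (2 ^ k))) \<le> 1"
      by (simp add: dyadic_prod_const)
    moreover have "trace (matrix_power (A ** B ** conj_transpose (A ** B)) (2 ^ k))
        = trace (matrix_power (?C ** ?D) (2 ^ k))"
      using trace_matrix_power_mult_commute[of "A ** ?D" "conj_transpose A" "2 ^ k"]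
      by (simp add: conj_transpose_mult matrix_mul_assoc)
    ultimately show ?thesis by simp
  qed
  hence "\<bar>Re (trace (dyadic_prod (Suc k) (\<lambda>i. f (2 * i) ** f (2 * i + 1))))\<bar> \<le> 1"
    by (intro Suc.IH) blast
  thus ?case by simp
qed

lemma trace_gram_power_nonneg:
  "0 \<le> Re (trace (matrix_power (A ** conj_transpose A) (2 ^ k)))"
proof (cases k)
  case 0
  thus ?thesis by (simp add: trace_gram)
next
  case (Suc l)
  let ?H = "matrix_power (A ** conj_transpose A) (2 ^ l)"
  have "matrix_power (A ** conj_transpose A) (2 ^ k) = ?H ** conj_transpose ?H"
    by (simp add: Suc mult_2 matrix_power_add conj_transpose_matrix_power conj_transpose_mult)
  thus ?thesis by (simp add: trace_gram)
qed

text \<open>The Hoelder inequality with equal factors; homogeneity removes its normalization.\<close>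

lemma trace_power_le_trace_gram_power:
  "\<bar>Re (trace (matrix_power A (2 * 2 ^ k)))\<bar>
    \<le> Re (trace (matrix_power (A ** conj_transpose A) (2 ^ k)))" (is "_ \<le> ?S A")
proof (rule dense_ge)
  fix c assume c: "?S A < c"
  have "c > 0" using c trace_gram_power_nonneg[of A k] by linarith
  \<comment> \<open>Scaling by \<open>r\<close> multiplies both traces by \<open>1 / c\<close>. A strict upper bound \<open>c\<close> is used because
    the right-hand side itself may vanish.\<close>
  define r where "r = root (2 * 2 ^ k) (1 / c)"
  have r: "r ^ (2 * 2 ^ k) = 1 / c"
    unfolding r_def using \<open>c > 0\<close> by (intro real_root_pow_pos2) auto
  have "?S (r *\<^sub>R A) = r ^ (2 * 2 ^ k) * ?S A"
    by (simp add: conj_transpose_scaleR matrix_mult.scaleR_left matrix_mult.scaleR_right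
        matrix_power_scaleR trace_scaleR power_mult power2_eq_square)
  also have "\<dots> \<le> 1" using c \<open>c > 0\<close> by (simp add: r)
  finally have "?S (r *\<^sub>R A) \<le> 1" .
  hence "\<bar>Re (trace (dyadic_prod (Suc k) (\<lambda>_. r *\<^sub>R A)))\<bar> \<le> 1"
    by (intro trace_dyadic_prod_le_1)
  hence "\<bar>Re (trace (matrix_power (r *\<^sub>R A) (2 * 2 ^ k)))\<bar> \<le> 1"
    unfolding dyadic_prod_const by simp
  thus "\<bar>Re (trace (matrix_power A (2 * 2 ^ k)))\<bar> \<le> c"
    using \<open>c > 0\<close> unfolding matrix_power_scaleR r by (simp add: trace_scaleR abs_mult)
qed

text \<open>For Hermitian factors the Gram matrix of \<open>AB\<close> is \<open>ABBA\<close>, which is \<open>A\<^sup>2B\<^sup>2\<close> up to a cyclic shift. So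
  each use of the previous lemma halves the exponent and squares the factors.\<close>

lemma trace_power_mult_le:
  assumes "hermitian_matrix A" "hermitian_matrix B"
  shows "Re (trace (matrix_power (A ** B) (2 ^ k)))
    \<le> Re (trace (matrix_power A (2 ^ k) ** matrix_power B (2 ^ k)))"
  using assms
proof (induction k arbitrary: A B)
  case (Suc k)
  have herm: "conj_transpose A = A" "conj_transpose B = B"
    using Suc.prems by (simp_all add: hermitian_matrix_def)
  have "Re (trace (matrix_power (A ** B) (2 ^ Suc k)))
      \<le> Re (trace (matrix_power (A ** B ** conj_transpose (A ** B)) (2 ^ k)))"
    using trace_power_le_trace_gram_power[of "A ** B" k] by (simp del: matrix_power_Suc)
  also have "trace (matrix_power (A ** B ** conj_transpose (A ** B)) (2 ^ k))
      = trace (matrix_power ((A ** A) ** (B ** B)) (2 ^ k))"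
    using trace_matrix_power_mult_commute[of "A ** B ** B" A "2 ^ k"]
    by (simp add: conj_transpose_mult herm matrix_mul_assoc)
  also have "Re \<dots> \<le> Re (trace (matrix_power (A ** A) (2 ^ k) ** matrix_power (B ** B) (2 ^ k)))"
    by (rule Suc.IH) (simp_all add: hermitian_matrix_def conj_transpose_mult herm)
  finally show ?case by (simp add: matrix_power_double)
qed simp

section \<open>The matrix exponential as a limit of powers\<close>

lemma matrix_power_bound:
  obtains K where "K > 0"
    "\<And>(A :: complex^'n^'n) k. norm (matrix_power A k) \<le> norm (mat 1 :: complex^'n^'n) * (K * norm A) ^ k"
proof -
  obtain K where K: "K > 0" "\<And>(A :: complex^'n^'n) (B :: complex^'n^'n). norm (A ** B) \<le> norm A * norm B * K"
    using matrix_mult.pos_bounded by blast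
  show ?thesis
  proof (rule that[OF K(1)])
    fix A :: "complex^'n^'n" and k
    show "norm (matrix_power A k) \<le> norm (mat 1 :: complex^'n^'n) * (K * norm A) ^ k"
    proof (induction k)
      case (Suc k)
      have "norm (matrix_power A (Suc k)) \<le> (K * norm A) * norm (matrix_power A k)"
        using K(2)[of A "matrix_power A k"] by (simp add: ac_simps)
      also have "\<dots> \<le> (K * norm A) * (norm (mat 1 :: complex^'n^'n) * (K * norm A) ^ k)"
        using K(1) Suc by (intro mult_left_mono) auto
      finally show ?case by (simp add: ac_simps)
    qed simp
  qed
qed

lemma summable_exp_majorant: "summable (\<lambda>k. c * x ^ k / fact k :: real)"
  using summable_mult[OF summable_exp_generic[of x], of c] by (simp add: field_simps scaleR_conv_of_real)

lemma summable_matrix_exp: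
  fixes A :: "complex^'n^'n"
  shows "summable (\<lambda>k. matrix_power A k /\<^sub>R fact k)"
proof -
  obtain K where K: "\<And>k. norm (matrix_power A k) \<le> norm (mat 1 :: complex^'n^'n) * (K * norm A) ^ k"
    using matrix_power_bound by metis
  show ?thesis
    by (rule summable_comparison_test[OF _ summable_exp_majorant[of "norm (mat 1 :: complex^'n^'n)" "K * norm A"]])
       (auto simp: divide_inverse mult.commute intro!: mult_left_mono K)
qed

lemma matrix_exp_image:
  assumes "bounded_linear L"
  shows "L (matrix_exp A) = (\<Sum>k. L (matrix_power A k) /\<^sub>R fact k)"
proof -
  interpret bounded_linear L by fact
  show ?thesis
    unfolding matrix_exp_def using suminf[OF summable_matrix_exp[of A]] by (simp add: scale)
qed

lemma binomial_theorem_matrix: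
  "matrix_power (mat 1 + A) n = (\<Sum>k\<le>n. real (n choose k) *\<^sub>R matrix_power A k)"
proof (induction n)
  case (Suc n)
  have split: "(\<Sum>k\<le>n. real (n choose k) *\<^sub>R matrix_power A k)
      = mat 1 + (\<Sum>k\<le>n. real (n choose Suc k) *\<^sub>R matrix_power A (Suc k))"
    using sum.atMost_Suc_shift[of "\<lambda>k. real (n choose k) *\<^sub>R matrix_power A k" n]
    unfolding sum.atMost_Suc by (simp add: binomial_eq_0)
  have "matrix_power (mat 1 + A) (Suc n) = matrix_power (mat 1 + A) n + A ** matrix_power (mat 1 + A) n"
    by (simp add: matrix_mult.add_left)
  also have "\<dots> = mat 1 + (\<Sum>k\<le>n. real (n choose Suc k) *\<^sub>R matrix_power A (Suc k))
      + (\<Sum>k\<le>n. real (n choose k) *\<^sub>R matrix_power A (Suc k))"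
    unfolding Suc.IH matrix_mult.sum_right by (subst split) (simp add: matrix_mult.scaleR_right)
  also have "\<dots> = (\<Sum>k\<le>Suc n. real (Suc n choose k) *\<^sub>R matrix_power A k)"
    unfolding sum.atMost_Suc_shift by (simp add: sum.distrib algebra_simps del: sum.atMost_Suc)
  finally show ?case .
qed simp

lemma binomial_over_power_tendsto: "(\<lambda>n. real (n choose k) / real n ^ k) \<longlonglongrightarrow> 1 / fact k"
proof -
  have "(\<lambda>n. (\<Prod>i=0..<k. (1 - real i / real n) / real (k - i))) \<longlonglongrightarrow> (\<Prod>i=0..<k. (1 - 0) / real (k - i))"
    by (intro tendsto_intros lim_const_over_n) auto
  also have "(\<Prod>i=0..<k. (1 - 0) / real (k - i)) = 1 / fact k"
    by (simp add: fact_prod_rev prod_dividef)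
  finally show ?thesis
  proof (rule Lim_transform_eventually)
    show "\<forall>\<^sub>F n in sequentially. (\<Prod>i=0..<k. (1 - real i / real n) / real (k - i)) = real (n choose k) / real n ^ k"
      using eventually_ge_at_top[of "Suc k"]
    proof eventually_elim
      case (elim n)
      have "real (n choose k) / real n ^ k = (\<Prod>i=0..<k. (real (n - i) / real (k - i)) / real n)"
        using elim unfolding prod_dividef[of _ "\<lambda>_. real n"] by (simp add: binomial_altdef_of_nat)
      also have "\<dots> = (\<Prod>i=0..<k. (1 - real i / real n) / real (k - i))"
        using elim by (intro prod.cong) (auto simp: field_simps of_nat_diff)
      finally show ?case ..
    qed
  qed
qed

text \<open>
  The binomial theorem writes the power as a series whose \<open>k\<close>-th term tends to \<open>C\<^sup>k / k!\<close>. As the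
  sequence \<open>D\<close> is bounded, an exponential series dominates these series uniformly in \<open>n\<close>, so
  Tannery's theorem, applied to each complex entry, gives the limit.
\<close>

theorem matrix_power_tendsto_exp:
  fixes D :: "nat \<Rightarrow> complex^'n^'n"
  assumes D: "D \<longlonglongrightarrow> C"
  shows "(\<lambda>n. matrix_power (mat 1 + D n /\<^sub>R real n) n) \<longlonglongrightarrow> matrix_exp C"
proof -
  obtain K where K: "K > 0"
    "\<And>(A :: complex^'n^'n) k. norm (matrix_power A k) \<le> norm (mat 1 :: complex^'n^'n) * (K * norm A) ^ k"
    using matrix_power_bound by blast
  obtain R where R: "R > 0" "\<And>n. norm (D n) \<le> R"
    using D convergent_imp_Bseq[of D] by (auto simp: convergent_def Bseq_def)
  define T where "T k n = (real (n choose k) / real n ^ k) *\<^sub>R matrix_power (D n) k" for k n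
  define N1 where "N1 = norm (mat 1 :: complex^'n^'n)"
  have T_bound: "norm (T k n) \<le> N1 * (K * R) ^ k / fact k" for k n
  proof -
    have "real ((n choose k) * fact k) \<le> real (n ^ k)"
      using binomial_fact_pow of_nat_le_iff by blast
    hence "real (n choose k) / real n ^ k \<le> 1 / fact k"
    proof (cases "n = 0")
      case True
      thus ?thesis by (cases k) auto
    qed (simp add: field_simps)
    moreover have "norm (matrix_power (D n) k) \<le> N1 * (K * R) ^ k"
    proof -
      have "norm (matrix_power (D n) k) \<le> N1 * (K * norm (D n)) ^ k"
        unfolding N1_def by (rule K(2))
      also have "\<dots> \<le> N1 * (K * R) ^ k"
        using K(1) R by (intro mult_left_mono power_mono) (auto simp: N1_def)
      finally show ?thesis .
    qed
    ultimately have "norm (T k n) \<le> 1 / fact k * (N1 * (K * R) ^ k)"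
      unfolding T_def norm_scaleR by (intro mult_mono) auto
    thus ?thesis by simp
  qed
  have power_limit: "(\<lambda>n. matrix_power (D n) k) \<longlonglongrightarrow> matrix_power C k" for k
    by (induction k) (auto intro: matrix_mult.tendsto D)
  have T_limit: "(\<lambda>n. T k n) \<longlonglongrightarrow> matrix_power C k /\<^sub>R fact k" for k
    unfolding T_def using tendsto_scaleR[OF binomial_over_power_tendsto power_limit, of k k]
    by (simp add: divide_inverse)
  have T_sum: "matrix_power (mat 1 + D n /\<^sub>R real n) n = (\<Sum>k. T k n)" for n
  proof -
    have "(\<Sum>k. T k n) = (\<Sum>k\<le>n. T k n)"
      by (rule suminf_finite) (auto simp: T_def)
    thus ?thesis
      by (simp add: T_def binomial_theorem_matrix matrix_power_scaleR divide_inverse power_inverse)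
  qed
  have T_summable: "summable (\<lambda>k. T k n)" for n
    by (rule summable_comparison_test[OF _ summable_exp_majorant[of N1 "K * R"]]) (use T_bound in auto)
  show ?thesis
  proof (rule vec_tendstoI, rule vec_tendstoI)
    fix i j
    have entry: "bounded_linear (\<lambda>A :: complex^'n^'n. A $ i $ j)"
      by (rule bounded_linear_compose[OF bounded_linear_vec_nth bounded_linear_vec_nth])
    have "(\<lambda>n. \<Sum>k. T k n $ i $ j) \<longlonglongrightarrow> (\<Sum>k. (matrix_power C k /\<^sub>R fact k) $ i $ j)"
    proof (rule tannerys_theorem[THEN conjunct2, THEN conjunct2])
      show "(\<lambda>n. T k n $ i $ j) \<longlonglongrightarrow> (matrix_power C k /\<^sub>R fact k) $ i $ j" for k
        by (intro tendsto_vec_nth T_limit)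
      have "norm (T k n $ i $ j) \<le> N1 * (K * R) ^ k / fact k" for k n
        using T_bound[of k n] Finite_Cartesian_Product.norm_nth_le[of "T k n" i]
          Finite_Cartesian_Product.norm_nth_le[of "T k n $ i" j] by linarith
      thus "\<forall>\<^sub>F (k, n) in sequentially \<times>\<^sub>F sequentially.
          norm (T k n $ i $ j) \<le> N1 * (K * R) ^ k / fact k"
        by (simp add: case_prod_unfold)
    qed (auto intro: summable_exp_majorant)
    thus "(\<lambda>n. matrix_power (mat 1 + D n /\<^sub>R real n) n $ i $ j) \<longlonglongrightarrow> matrix_exp C $ i $ j"
      unfolding T_sum matrix_exp_def
      by (simp only: bounded_linear.suminf[OF entry T_summable] bounded_linear.suminf[OF entry summable_matrix_exp])
  qed
qed

section \<open>The Golden-Thompson inequality\<close>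

lemma hermitian_matrix_add: "hermitian_matrix A \<Longrightarrow> hermitian_matrix B \<Longrightarrow> hermitian_matrix (A + B)"
  by (simp add: hermitian_matrix_def linear_add[OF bounded_linear.linear[OF bounded_linear_conj_transpose]])

lemma hermitian_matrix_scaleR: "hermitian_matrix A \<Longrightarrow> hermitian_matrix (c *\<^sub>R A)"
  by (simp add: hermitian_matrix_def conj_transpose_scaleR)

lemma hermitian_matrix_mat_1: "hermitian_matrix (mat 1)"
  by (simp add: hermitian_matrix_def)

lemma hermitian_matrix_congruence:
  "hermitian_matrix A \<Longrightarrow> hermitian_matrix (g ** A ** conj_transpose g)"
  by (simp add: hermitian_matrix_def conj_transpose_mult matrix_mul_assoc)

lemma conj_transpose_matrix_exp: "conj_transpose (matrix_exp A) = matrix_exp (conj_transpose A)"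
  by (simp add: matrix_exp_image[OF bounded_linear_conj_transpose] conj_transpose_matrix_power)
     (simp add: matrix_exp_def)

lemma Im_trace_matrix_exp: "hermitian_matrix A \<Longrightarrow> Im (trace (matrix_exp A)) = 0"
  using trace_conj_transpose[of "matrix_exp A"]
  by (simp add: conj_transpose_matrix_exp hermitian_matrix_def complex_eq_iff)

lemma continuous_on_matrix_mult:
  fixes f :: "'a::topological_space \<Rightarrow> complex^'n^'m" and g :: "'a \<Rightarrow> complex^'p^'n"
  shows "continuous_on S f \<Longrightarrow> continuous_on S g \<Longrightarrow> continuous_on S (\<lambda>x. f x ** g x)"
  by (rule bounded_bilinear.continuous_on[OF bounded_bilinear_matrix_mult])

lemmas tendsto_trace = bounded_linear.tendsto[OF bounded_linear_trace]

lemma matrix_power_tendsto_exp_dyadic: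
  assumes "D \<longlonglongrightarrow> C"
  shows "(\<lambda>k. matrix_power (mat 1 + D (2 ^ k) /\<^sub>R 2 ^ k) (2 ^ k)) \<longlonglongrightarrow> matrix_exp C"
proof -
  have "strict_mono (\<lambda>k. 2 ^ k :: nat)"
    by (rule strict_monoI) simp
  from LIMSEQ_subseq_LIMSEQ[OF matrix_power_tendsto_exp[OF assms] this]
  show ?thesis by (simp add: o_def)
qed

text \<open>The product of \<open>I + A/n\<close> and \<open>I + B/n\<close> is \<open>I + D\<^sub>n/n\<close> with \<open>D\<^sub>n\<close> tending to \<open>A + B\<close>. So the
  inequality is the limit of \<open>trace_power_mult_le\<close> for these two Hermitian factors.\<close>

theorem golden_thompson:
  fixes A B :: "complex^'n^'n"
  assumes "hermitian_matrix A" "hermitian_matrix B"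
  shows "Re (trace (matrix_exp (A + B))) \<le> Re (trace (matrix_exp A ** matrix_exp B))"
proof -
  define D where "D n = A + B + (A ** B) /\<^sub>R real n" for n
  have "(\<lambda>n. inverse (real n) *\<^sub>R (A ** B)) \<longlonglongrightarrow> 0 *\<^sub>R (A ** B)"
    by (intro tendsto_intros lim_inverse_n)
  from tendsto_add[OF tendsto_const[of "A + B"] this] have "D \<longlonglongrightarrow> A + B"
    by (simp add: D_def[abs_def])
  hence lhs: "(\<lambda>k. Re (trace (matrix_power (mat 1 + D (2 ^ k) /\<^sub>R 2 ^ k) (2 ^ k))))
      \<longlonglongrightarrow> Re (trace (matrix_exp (A + B)))"
    by (intro tendsto_Re tendsto_trace matrix_power_tendsto_exp_dyadic)
  have rhs: "(\<lambda>k. Re (trace (matrix_power (mat 1 + A /\<^sub>R 2 ^ k) (2 ^ k) ** matrix_power (mat 1 + B /\<^sub>R 2 ^ k) (2 ^ k))))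
      \<longlonglongrightarrow> Re (trace (matrix_exp A ** matrix_exp B))"
    by (intro tendsto_Re tendsto_trace matrix_mult.tendsto matrix_power_tendsto_exp_dyadic tendsto_const)
  show ?thesis
  proof (rule LIMSEQ_le[OF lhs rhs], intro exI allI impI)
    fix k :: nat
    have "mat 1 + D (2 ^ k) /\<^sub>R 2 ^ k = (mat 1 + A /\<^sub>R 2 ^ k) ** (mat 1 + B /\<^sub>R 2 ^ k)"
      by (simp add: D_def matrix_mult.add_left matrix_mult.add_right matrix_mult.scaleR_left
          matrix_mult.scaleR_right scaleR_add_right)
    thus "Re (trace (matrix_power (mat 1 + D (2 ^ k) /\<^sub>R 2 ^ k) (2 ^ k)))
        \<le> Re (trace (matrix_power (mat 1 + A /\<^sub>R 2 ^ k) (2 ^ k) ** matrix_power (mat 1 + B /\<^sub>R 2 ^ k) (2 ^ k)))"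
      by (simp only:)
         (intro trace_power_mult_le hermitian_matrix_add hermitian_matrix_scaleR hermitian_matrix_mat_1 assms)
  qed
qed

text \<open>An even power of the Hermitian matrix \<open>I + A/n\<close> is the Gram matrix of half that power, and the
  half power tends to the exponential of \<open>A/2\<close>.\<close>

lemma trace_matrix_exp_eq_norm:
  fixes A :: "complex^'n^'n"
  assumes "hermitian_matrix A"
  shows "Re (trace (matrix_exp A)) = norm (matrix_exp (A /\<^sub>R 2)) ^ 2"
proof (rule LIMSEQ_unique)
  have "(\<lambda>k. Re (trace (matrix_power (mat 1 + A /\<^sub>R 2 ^ k) (2 ^ k)))) \<longlonglongrightarrow> Re (trace (matrix_exp A))"
    by (intro tendsto_Re tendsto_trace matrix_power_tendsto_exp_dyadic tendsto_const)
  from LIMSEQ_Suc[OF this]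
  show "(\<lambda>k. Re (trace (matrix_power (mat 1 + A /\<^sub>R 2 ^ Suc k) (2 ^ Suc k)))) \<longlonglongrightarrow> Re (trace (matrix_exp A))" .
  let ?H = "\<lambda>k. matrix_power (mat 1 + A /\<^sub>R 2 /\<^sub>R 2 ^ k) (2 ^ k)"
  have "Re (trace (matrix_power (mat 1 + A /\<^sub>R 2 ^ Suc k) (2 ^ Suc k))) = norm (?H k) ^ 2" for k
  proof -
    have "hermitian_matrix (mat 1 + A /\<^sub>R 2 /\<^sub>R 2 ^ k)"
      by (intro hermitian_matrix_add hermitian_matrix_scaleR hermitian_matrix_mat_1 assms)
    hence "conj_transpose (?H k) = ?H k"
      by (simp add: conj_transpose_matrix_power hermitian_matrix_def)
    moreover have "matrix_power (mat 1 + A /\<^sub>R 2 ^ Suc k) (2 ^ Suc k) = ?H k ** ?H k"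
    proof -
      have "A /\<^sub>R 2 ^ Suc k = A /\<^sub>R 2 /\<^sub>R 2 ^ k"
        by (simp add: mult.commute)
      moreover have "2 ^ Suc k = 2 ^ k + (2 ^ k :: nat)"
        by simp
      ultimately show ?thesis
        by (simp only: matrix_power_add)
    qed
    ultimately show ?thesis
      using trace_gram[of "?H k"] by simp
  qed
  moreover have "(\<lambda>k. norm (?H k) ^ 2) \<longlonglongrightarrow> norm (matrix_exp (A /\<^sub>R 2)) ^ 2"
    by (intro tendsto_power tendsto_norm matrix_power_tendsto_exp_dyadic tendsto_const)
  ultimately show "(\<lambda>k. Re (trace (matrix_power (mat 1 + A /\<^sub>R 2 ^ Suc k) (2 ^ Suc k))))
      \<longlonglongrightarrow> norm (matrix_exp (A /\<^sub>R 2)) ^ 2" by presburger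
qed

lemma matrix_exp_0: "matrix_exp 0 = mat 1"
  using LIMSEQ_unique[OF matrix_power_tendsto_exp[OF tendsto_const[of 0]]] by auto

text \<open>If \<open>e\<^sup>A\<close> vanished, Golden-Thompson for \<open>A\<close> and \<open>-A\<close> would bound the trace of the identity by zero.\<close>

lemma matrix_exp_neq_0:
  fixes A :: "complex^'n^'n"
  assumes "hermitian_matrix A"
  shows "matrix_exp A \<noteq> 0"
proof
  assume "matrix_exp A = 0"
  moreover have "hermitian_matrix (- A)"
    using hermitian_matrix_scaleR[OF assms, of "-1"] by simp
  ultimately have "Re (trace (matrix_exp (A + - A))) \<le> 0"
    using golden_thompson[OF assms, of "- A"] by (simp add: matrix_mult.zero_left trace_def)
  thus False by (simp add: matrix_exp_0 trace_I)
qed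

lemma partition_fn_pos:
  assumes "hermitian_matrix A"
  shows "partition_fn A > 0"
  using matrix_exp_neq_0[OF hermitian_matrix_scaleR[OF assms, of "inverse 2"]]
  by (simp add: partition_fn_def trace_matrix_exp_eq_norm[OF assms])

section \<open>Unitary conjugation and averaging\<close>

lemma matrix_inv_unitary:
  fixes g :: "complex^'n^'n"
  assumes "unitary_matrix g"
  shows "matrix_inv g = conj_transpose g"
proof -
  have "g ** matrix_inv g = mat 1"
    unfolding matrix_inv_def using assms
    by (rule_tac someI2[of _ "conj_transpose g"]) (auto simp: unitary_matrix_def)
  hence "conj_transpose g ** (g ** matrix_inv g) = conj_transpose g"
    by simp
  thus ?thesis using assms by (simp add: matrix_mul_assoc unitary_matrix_def)
qed

lemma matrix_exp_unitary_conj: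
  assumes "unitary_matrix g"
  shows "matrix_exp (g ** A ** conj_transpose g) = g ** matrix_exp A ** conj_transpose g"
proof -
  have "matrix_power (g ** A ** conj_transpose g) k = g ** matrix_power A k ** conj_transpose g" for k
  proof (induction k)
    case (Suc k)
    have "matrix_power (g ** A ** conj_transpose g) (Suc k)
        = g ** A ** (conj_transpose g ** g) ** matrix_power A k ** conj_transpose g"
      by (simp add: Suc matrix_mul_assoc)
    also have "conj_transpose g ** g = mat 1"
      using assms by (simp add: unitary_matrix_def)
    finally show ?case by (simp add: matrix_mul_assoc)
  qed (use assms in \<open>simp add: unitary_matrix_def\<close>)
  note power = this
  have "bounded_linear (\<lambda>X. g ** X ** conj_transpose g)"
    by (rule bounded_linear_compose[OF matrix_mult.bounded_linear_left matrix_mult.bounded_linear_right])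
  from matrix_exp_image[OF this, of A] show ?thesis
    by (simp add: matrix_exp_def power)
qed

lemma partition_fn_unitary_conj_add_le:
  fixes A B g :: "complex^'n^'n"
  assumes "unitary_matrix g" "hermitian_matrix A" "hermitian_matrix B"
  shows "partition_fn (g ** A ** conj_transpose g + B)
    \<le> Re (trace (g ** matrix_exp A ** conj_transpose g ** matrix_exp B)) / real CARD('n)"
  using golden_thompson[OF hermitian_matrix_congruence[OF assms(2), of g] assms(3)]
  by (simp add: partition_fn_def matrix_exp_unitary_conj[OF assms(1)] divide_right_mono)

text \<open>Jensen's inequality in the form needed here. The tangent line of the logarithm at \<open>c\<close> gives the bound
  pointwise, with an error term \<open>h / c - 1\<close> that integrates to zero.\<close>

lemma (in prob_space) integral_ln_le_ln_bound:
  fixes z h :: "'a \<Rightarrow> real"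
  assumes "integrable M (\<lambda>x. ln (z x))" "integrable M h"
    and "\<And>x. x \<in> space M \<Longrightarrow> 0 < z x" "\<And>x. x \<in> space M \<Longrightarrow> z x \<le> h x"
    and "(LINT x|M. h x) = c" "0 < c"
  shows "(LINT x|M. ln (z x)) \<le> ln c"
proof -
  have "(LINT x|M. ln (z x)) \<le> (LINT x|M. ln c - 1 + h x / c)"
  proof (rule integral_mono)
    fix x assume x: "x \<in> space M"
    have "ln (z x) - ln c = ln (z x / c)"
      using assms(3)[OF x] assms(6) by (simp add: ln_div)
    also have "\<dots> \<le> z x / c - 1"
      using assms(3)[OF x] assms(6) by (intro ln_le_minus_one) simp
    also have "\<dots> \<le> h x / c - 1"
      using assms(4)[OF x] assms(6) by (simp add: divide_right_mono)
    finally show "ln (z x) \<le> ln c - 1 + h x / c" by simp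
  qed (use assms in auto)
  also have "\<dots> = ln c"
    using assms by (simp add: prob_space)
  finally show ?thesis .
qed

lemma trace_mat_mult: "trace (mat c ** A) = c * trace (A :: complex^'n^'n)"
  by (simp add: trace_def matrix_matrix_mult_def mat_def if_distrib[of "\<lambda>x. x * _"] sum_distrib_left
      cong: if_cong)

text \<open>A linear functional commutes with the Haar average, and the average of the conjugates is a multiple
  of the identity. The real part of the trace factorizes because the trace of \<open>e\<^sup>A\<close> is real.\<close>

lemma trace_symmetrized:
  fixes A B :: "complex^'n^'n"
  assumes "symmetrizing \<mu> (matrix_exp A)" "hermitian_matrix A"
    and "integrable \<mu> (\<lambda>g. g ** matrix_exp A ** matrix_inv g)"
  shows "integrable \<mu> (\<lambda>g. Re (trace (g ** matrix_exp A ** matrix_inv g ** matrix_exp B)) / real CARD('n))"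
    and "(LINT g|\<mu>. Re (trace (g ** matrix_exp A ** matrix_inv g ** matrix_exp B)) / real CARD('n))
      = partition_fn A * partition_fn B"
proof -
  let ?T = "\<lambda>X :: complex^'n^'n. Re (trace (X ** matrix_exp B)) / real CARD('n)"
  have T: "bounded_linear ?T"
    by (intro bounded_linear_compose[OF bounded_linear_divide] bounded_linear_compose[OF bounded_linear_Re]
        bounded_linear_compose[OF bounded_linear_trace] matrix_mult.bounded_linear_left)
  show "integrable \<mu> (\<lambda>g. ?T (g ** matrix_exp A ** matrix_inv g))"
    by (rule integrable_bounded_linear[OF T assms(3)])
  have "(LINT g|\<mu>. ?T (g ** matrix_exp A ** matrix_inv g))
      = ?T (mat (trace (matrix_exp A) / of_nat CARD('n)))"
    using integral_bounded_linear[OF T assms(3)] assms(1) by (simp add: symmetrizing_def)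
  also have "\<dots> = partition_fn A * partition_fn B"
    using Im_trace_matrix_exp[OF assms(2)] by (simp add: trace_mat_mult partition_fn_def Re_divide_of_nat)
  finally show "(LINT g|\<mu>. ?T (g ** matrix_exp A ** matrix_inv g)) = partition_fn A * partition_fn B" .
qed

section \<open>Measurability\<close>

lemma continuous_on_matrix_power:
  fixes f :: "'a::topological_space \<Rightarrow> complex^'n^'n"
  assumes "continuous_on S f"
  shows "continuous_on S (\<lambda>x. matrix_power (f x) k)"
  by (induction k) (auto intro: continuous_on_matrix_mult assms)

lemma measurable_matrix_exp [measurable]:
  "(matrix_exp :: complex^'n^'n \<Rightarrow> _) \<in> borel_measurable borel"
proof (rule borel_measurable_LIMSEQ_metric)
  show "(\<lambda>A. matrix_power (mat 1 + A /\<^sub>R real n) n) \<in> borel_measurable borel" for n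
    by (intro borel_measurable_continuous_onI continuous_on_matrix_power continuous_intros)
qed (rule matrix_power_tendsto_exp[OF tendsto_const])

lemma measurable_partition_fn [measurable]:
  "(partition_fn :: complex^'n^'n \<Rightarrow> _) \<in> borel_measurable borel"
proof -
  have [measurable]: "(trace :: complex^'n^'n \<Rightarrow> _) \<in> borel_measurable borel"
    by (intro borel_measurable_continuous_onI linear_continuous_on bounded_linear_trace)
  show ?thesis unfolding partition_fn_def[abs_def] by measurable
qed

lemma continuous_on_conj_transpose:
  fixes f :: "'a::topological_space \<Rightarrow> complex^'n^'m"
  shows "continuous_on S f \<Longrightarrow> continuous_on S (\<lambda>x. conj_transpose (f x))"
  by (rule bounded_linear.continuous_on[OF bounded_linear_conj_transpose])

lemma measurable_matrix_congruence:
  fixes f g :: "'a \<Rightarrow> complex^'n^'n"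
  assumes "f \<in> borel_measurable M" "g \<in> borel_measurable M"
  shows "(\<lambda>x. g x ** f x ** conj_transpose (g x)) \<in> borel_measurable M"
  by (rule borel_measurable_continuous_Pair[OF assms(2,1), where H = "\<lambda>g A. g ** A ** conj_transpose g"])
     (intro continuous_on_matrix_mult continuous_on_conj_transpose continuous_intros)

section \<open>Averaging over the group\<close>

text \<open>Conjugating only the first summand leaves the law of the sum unchanged: invariance preserves the
  first marginal, hence the product measure.\<close>

lemma distr_conj_add_eq_sum_law:
  fixes P\<^sub>1 P\<^sub>2 :: "(complex^'n^'n) measure"
  assumes "hermitian_law P\<^sub>1" "hermitian_law P\<^sub>2" "invariant_law G P\<^sub>1" "g \<in> G" "unitary_matrix g"
  shows "distr (P\<^sub>1 \<Otimes>\<^sub>M P\<^sub>2) borel (\<lambda>M. g ** fst M ** conj_transpose g + snd M) = sum_law P\<^sub>1 P\<^sub>2"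
proof -
  interpret P1: prob_space P\<^sub>1 using assms(1) by (simp add: hermitian_law_def)
  interpret P2: prob_space P\<^sub>2 using assms(2) by (simp add: hermitian_law_def)
  have sets [measurable_cong]: "sets P\<^sub>1 = sets borel" "sets P\<^sub>2 = sets borel"
    using assms(1,2) by (simp_all add: hermitian_law_def)
  let ?c = "\<lambda>M. g ** M ** conj_transpose g"
  have c [measurable]: "?c \<in> borel_measurable borel"
    by (intro measurable_matrix_congruence) auto
  have conj: "distr P\<^sub>1 borel ?c = P\<^sub>1"
    using assms(3,4) matrix_inv_unitary[OF assms(5)] unfolding invariant_law_def by metis
  have id: "distr P\<^sub>2 borel (\<lambda>M. M) = P\<^sub>2"
    by (rule distr_id2) (simp add: sets)
  have "P\<^sub>1 \<Otimes>\<^sub>M P\<^sub>2 = distr P\<^sub>1 borel ?c \<Otimes>\<^sub>M distr P\<^sub>2 borel (\<lambda>M. M)"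
    by (simp add: conj id)
  also have "\<dots> = distr (P\<^sub>1 \<Otimes>\<^sub>M P\<^sub>2) (borel \<Otimes>\<^sub>M borel) (\<lambda>(M, M'). (?c M, M'))"
    by (rule pair_measure_distr) (simp_all add: id P2.sigma_finite_measure_axioms)
  finally have prod: "P\<^sub>1 \<Otimes>\<^sub>M P\<^sub>2 = distr (P\<^sub>1 \<Otimes>\<^sub>M P\<^sub>2) (borel \<Otimes>\<^sub>M borel) (\<lambda>(M, M'). (?c M, M'))" .
  have "sum_law P\<^sub>1 P\<^sub>2 = distr (distr (P\<^sub>1 \<Otimes>\<^sub>M P\<^sub>2) (borel \<Otimes>\<^sub>M borel) (\<lambda>(M, M'). (?c M, M'))) borel (\<lambda>(M, M'). M + M')"
    unfolding sum_law_def by (subst prod) simp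
  also have "\<dots> = distr (P\<^sub>1 \<Otimes>\<^sub>M P\<^sub>2) borel (\<lambda>M. ?c (fst M) + snd M)"
    by (subst distr_distr) (auto simp: o_def case_prod_unfold)
  finally show ?thesis ..
qed

lemma (in prob_space) distr_pair_snd:
  assumes "sigma_finite_measure N"
  shows "distr (M \<Otimes>\<^sub>M N) N snd = N"
proof (rule measure_eqI)
  interpret N: sigma_finite_measure N by fact
  fix A assume A: "A \<in> sets (distr (M \<Otimes>\<^sub>M N) N snd)"
  hence "snd -` A \<inter> space (M \<Otimes>\<^sub>M N) = space M \<times> A"
    using sets.sets_into_space[of A N] by (auto simp: space_pair_measure)
  thus "emeasure (distr (M \<Otimes>\<^sub>M N) N snd) A = emeasure N A"
    using A by (simp add: emeasure_distr N.emeasure_pair_measure_Times emeasure_space_1)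
qed simp

text \<open>The orbit of a matrix under the compact group is bounded.\<close>

lemma integrable_group_orbit:
  fixes A :: "complex^'n^'n"
  assumes "compact_unitary_group G" "haar_prob_measure G \<mu>"
  shows "integrable \<mu> (\<lambda>g. g ** A ** matrix_inv g)"
proof -
  interpret prob_space \<mu> using assms(2) by (simp add: haar_prob_measure_def)
  have sets [measurable_cong]: "sets \<mu> = sets (restrict_space borel G)"
    using assms(2) by (simp add: haar_prob_measure_def)
  have space: "space \<mu> = G"
    using sets_eq_imp_space_eq[OF sets] by (simp add: space_restrict_space)
  have G: "compact G" and unitary: "\<And>g. g \<in> G \<Longrightarrow> unitary_matrix g"
    using assms(1) by (auto simp: compact_unitary_group_def)
  have "continuous_on G (\<lambda>g. g ** A ** conj_transpose g)"
    by (intro continuous_on_matrix_mult continuous_on_conj_transpose continuous_intros)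
  from compact_imp_bounded[OF compact_continuous_image[OF this G]]
  obtain b where b: "\<And>g. g \<in> G \<Longrightarrow> norm (g ** A ** conj_transpose g) \<le> b"
    by (auto simp: bounded_iff)
  have meas: "(\<lambda>g. g) \<in> borel_measurable \<mu>"
    using sets by (simp cong: measurable_cong_sets add: measurable_restrict_space1)
  have "integrable \<mu> (\<lambda>g. g ** A ** conj_transpose g)"
    by (rule integrable_const_bound[where B = b])
       (use b space meas in \<open>auto intro!: measurable_matrix_congruence AE_I2\<close>)
  also have "?this \<longleftrightarrow> ?thesis"
    by (rule Bochner_Integration.integrable_cong) (use space unitary in \<open>simp_all add: matrix_inv_unitary\<close>)
  finally show ?thesis .
qed

theorem theorem3p1:
  fixes G :: "(complex^'n^'n) set"
    and \<mu> P\<^sub>1 P\<^sub>2 :: "(complex^'n^'n) measure"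
  assumes "compact_unitary_group G"
    and "haar_prob_measure G \<mu>"
    and "hermitian_law P\<^sub>1"
    and "hermitian_law P\<^sub>2"
    and "finite_free_energy P\<^sub>1"
    and "finite_free_energy P\<^sub>2"
    and "finite_free_energy (sum_law P\<^sub>1 P\<^sub>2)"
    and "invariant_law G P\<^sub>1"
    and "AE M in P\<^sub>1. symmetrizing \<mu> (matrix_exp M)"
  shows "free_energy (sum_law P\<^sub>1 P\<^sub>2) \<le> free_energy P\<^sub>1 + free_energy P\<^sub>2"
proof -
  interpret \<mu>: prob_space \<mu> using assms(2) by (simp add: haar_prob_measure_def)
  interpret P1: prob_space P\<^sub>1 using assms(3) by (simp add: hermitian_law_def)
  interpret P2: prob_space P\<^sub>2 using assms(4) by (simp add: hermitian_law_def)
  interpret P12: pair_prob_space P\<^sub>1 P\<^sub>2 ..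
  define P where "P = P\<^sub>1 \<Otimes>\<^sub>M P\<^sub>2"
  interpret P: prob_space P unfolding P_def by (rule P12.prob_space_axioms)
  interpret Q: pair_sigma_finite \<mu> P ..
  have sets_\<mu>: "sets \<mu> = sets (restrict_space borel G)"
    using assms(2) by (simp add: haar_prob_measure_def)
  have space_\<mu>: "space \<mu> = G"
    using sets_eq_imp_space_eq[OF sets_\<mu>] by (simp add: space_restrict_space)
  have sets_P [measurable_cong]: "sets P\<^sub>1 = sets borel" "sets P\<^sub>2 = sets borel"
    using assms(3,4) by (simp_all add: hermitian_law_def)
  have unitary: "unitary_matrix g" if "g \<in> G" for g
    using assms(1) that by (auto simp: compact_unitary_group_def)
  have meas_fst [measurable]: "fst \<in> measurable P P\<^sub>1" and meas_snd [measurable]: "snd \<in> measurable P P\<^sub>2"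
    unfolding P_def by auto
  have marginal: "distr P P\<^sub>1 fst = P\<^sub>1" "distr P P\<^sub>2 snd = P\<^sub>2"
    unfolding P_def using P2.distr_pair_fst P1.distr_pair_snd[OF P2.sigma_finite_measure_axioms] by auto

  define S where "S g M = g ** fst M ** conj_transpose g + snd M"
    for g :: "complex^'n^'n" and M :: "(complex^'n^'n) \<times> (complex^'n^'n)"
  define f where "f g M = ln (partition_fn (S g M))" for g M

  have [measurable]: "(\<lambda>g. g) \<in> borel_measurable \<mu>"
    using sets_\<mu> by (simp cong: measurable_cong_sets add: measurable_restrict_space1)
  have [measurable]: "fst \<in> borel_measurable P" "snd \<in> borel_measurable P"
    using meas_fst meas_snd by (simp_all add: measurable_cong_sets[OF refl sets_P(1)] measurable_cong_sets[OF refl sets_P(2)])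
  have [measurable]: "S g \<in> borel_measurable P" for g
    unfolding S_def by (intro borel_measurable_add measurable_matrix_congruence) measurable
  have [measurable]: "(\<lambda>x. S (fst x) (snd x)) \<in> borel_measurable (\<mu> \<Otimes>\<^sub>M P)"
    unfolding S_def by (intro borel_measurable_add measurable_matrix_congruence) measurable
  have f_meas [measurable]: "case_prod f \<in> borel_measurable (\<mu> \<Otimes>\<^sub>M P)"
    unfolding f_def[abs_def] case_prod_unfold by measurable

  have law: "distr P borel (S g) = sum_law P\<^sub>1 P\<^sub>2" if "g \<in> G" for g
    unfolding P_def S_def by (rule distr_conj_add_eq_sum_law[OF assms(3,4,8) that unitary[OF that]])
  have f_integrable: "integrable P (f g)" if "g \<in> G" for g
    using assms(7) unfolding finite_free_energy_def f_def[abs_def] law[OF that, symmetric]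
    by (subst (asm) integrable_distr_eq) auto
  have f_integral: "(LINT M|P. f g M) = free_energy (sum_law P\<^sub>1 P\<^sub>2)" if "g \<in> G" for g
    unfolding free_energy_def f_def[abs_def] law[OF that, symmetric]
    by (subst integral_distr) auto
  have f_abs_integral: "(LINT M|P. norm (f g M)) = (LINT M|sum_law P\<^sub>1 P\<^sub>2. norm (ln (partition_fn M)))"
    if "g \<in> G" for g
    unfolding f_def[abs_def] law[OF that, symmetric] by (subst integral_distr) auto
  \<comment> \<open>The absolute integral over \<open>P\<close> is the same for all \<open>g\<close>, since the law of \<open>S g\<close> is. This is what
    makes \<open>f\<close> jointly integrable and allows the order of integration to be exchanged.\<close>
  have joint: "integrable (\<mu> \<Otimes>\<^sub>M P) (case_prod f)"
  proof (rule Q.Fubini_integrable[OF f_meas])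
    have "integrable \<mu> (\<lambda>g. LINT M|sum_law P\<^sub>1 P\<^sub>2. norm (ln (partition_fn M)))"
      by (rule \<mu>.integrable_const)
    also have "?this \<longleftrightarrow> integrable \<mu> (\<lambda>g. LINT M|P. norm (case_prod f (g, M)))"
      by (rule Bochner_Integration.integrable_cong) (use f_abs_integral space_\<mu> in auto)
    finally show "integrable \<mu> (\<lambda>g. LINT M|P. norm (case_prod f (g, M)))" .
    show "AE g in \<mu>. integrable P (\<lambda>M. case_prod f (g, M))"
      by (rule AE_I2) (simp add: f_integrable space_\<mu>)
  qed

  have "AE M in P\<^sub>1. symmetrizing \<mu> (matrix_exp M) \<and> hermitian_matrix M"
    using assms(3,9) by (auto simp: hermitian_law_def)
  hence "AE M in distr P P\<^sub>1 fst. symmetrizing \<mu> (matrix_exp M) \<and> hermitian_matrix M"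
    by (simp only: marginal)
  from AE_distrD[OF meas_fst this]
  have AE1: "AE M in P. symmetrizing \<mu> (matrix_exp (fst M)) \<and> hermitian_matrix (fst M)" .
  have "AE M in distr P P\<^sub>2 snd. hermitian_matrix M"
    using assms(4) by (simp only: marginal hermitian_law_def)
  from AE_distrD[OF meas_snd this]
  have AE2: "AE M in P. hermitian_matrix (snd M)" .

  have bound: "AE M in P. (LINT g|\<mu>. f g M) \<le> ln (partition_fn (fst M)) + ln (partition_fn (snd M))"
    using AE1 AE2 Q.AE_integrable_snd[OF joint]
  proof eventually_elim
    case (elim M)
    let ?A = "fst M" and ?B = "snd M"
    let ?h = "\<lambda>g. Re (trace (g ** matrix_exp ?A ** matrix_inv g ** matrix_exp ?B)) / real CARD('n)"
    have A: "hermitian_matrix ?A" and B: "hermitian_matrix ?B" using elim by auto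
    note average = trace_symmetrized[OF conjunct1[OF elim(1)] A integrable_group_orbit[OF assms(1,2)], of ?B]
    have "(LINT g|\<mu>. f g M) \<le> ln (partition_fn ?A * partition_fn ?B)"
      unfolding f_def
    proof (rule \<mu>.integral_ln_le_ln_bound[OF _ average(1) _ _ average(2)])
      show "integrable \<mu> (\<lambda>g. ln (partition_fn (S g M)))"
        using elim(3) by (simp add: f_def)
      fix g assume "g \<in> space \<mu>"
      hence g: "unitary_matrix g" using unitary space_\<mu> by auto
      show "partition_fn (S g M) > 0"
        unfolding S_def by (intro partition_fn_pos hermitian_matrix_add hermitian_matrix_congruence A B)
      show "partition_fn (S g M) \<le> ?h g"
        unfolding S_def matrix_inv_unitary[OF g] by (rule partition_fn_unitary_conj_add_le[OF g A B])
    qed (use partition_fn_pos[OF A] partition_fn_pos[OF B] in simp)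
    thus ?case
      using partition_fn_pos[OF A] partition_fn_pos[OF B] by (simp add: ln_mult)
  qed

  have ln_meas: "(\<lambda>M. ln (partition_fn M)) \<in> borel_measurable P\<^sub>1"
      "(\<lambda>M. ln (partition_fn M)) \<in> borel_measurable P\<^sub>2"
    by (simp_all add: measurable_cong_sets[OF sets_P(1) refl] measurable_cong_sets[OF sets_P(2) refl])
  have int1: "integrable P (\<lambda>M. ln (partition_fn (fst M)))"
    using assms(5) unfolding finite_free_energy_def
    by (subst (asm) marginal(1)[symmetric], subst (asm) integrable_distr_eq) auto
  have int2: "integrable P (\<lambda>M. ln (partition_fn (snd M)))"
    using assms(6) unfolding finite_free_energy_def
    by (subst (asm) marginal(2)[symmetric], subst (asm) integrable_distr_eq) auto
  have fe1: "(LINT M|P. ln (partition_fn (fst M))) = free_energy P\<^sub>1"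
    using integral_distr[OF meas_fst ln_meas(1)] by (simp add: marginal free_energy_def)
  have fe2: "(LINT M|P. ln (partition_fn (snd M))) = free_energy P\<^sub>2"
    using integral_distr[OF meas_snd ln_meas(2)] by (simp add: marginal free_energy_def)

  have "free_energy (sum_law P\<^sub>1 P\<^sub>2) = (LINT g|\<mu>. free_energy (sum_law P\<^sub>1 P\<^sub>2))"
    by (simp add: \<mu>.prob_space)
  also have "\<dots> = (LINT g|\<mu>. LINT M|P. f g M)"
    by (rule Bochner_Integration.integral_cong) (simp_all add: f_integral space_\<mu>)
  also have "\<dots> = (LINT M|P. LINT g|\<mu>. f g M)"
    by (rule Q.Fubini_integral[OF joint, symmetric])
  also have "\<dots> \<le> (LINT M|P. ln (partition_fn (fst M)) + ln (partition_fn (snd M)))"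
    by (intro integral_mono_AE Q.integrable_snd[OF joint] Bochner_Integration.integrable_add int1 int2 bound)
  also have "\<dots> = free_energy P\<^sub>1 + free_energy P\<^sub>2"
    by (simp add: int1 int2 fe1 fe2)
  finally show ?thesis .
qed

end
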